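(* Let $\Sigma(r)$ be one of the functions $\sin r$, $\sinh r$, or $1$, let $X(\zeta,\bar\zeta)$ and $Z(\zeta,\bar\zeta)$ be smooth real-valued functions of the complex coordinate $\zeta$, and consider the (timelike-surface homogeneous) metric $$ds^2 = e^{2X(\zeta,\bar\zeta)}\Bigl(\Sigma^2(r)\,dt^2 - dr^2 - 2e^{2Z(\zeta,\bar\zeta)}\,d\zeta\,d\bar\zeta\Bigr)$$ in coordinates $(t,r,\zeta,\bar\zeta)$, on a coordinate domain where $\Sigma(r)\neq 0$. Let $Y$ be a smooth complex-valued function of $(\zeta,\bar\zeta)$ with complex conjugate $\bar Y$, let $\mathcal{C}$ be a real constant, and set $$\xi^a = Y\,\partial_\zeta + \bar{Y}\,\partial_{\bar\zeta} + \mathcal{C}\,(t\,\partial_t + r\,\partial_r).$$ Then $\xi^a$ is a conformal vector of the metric if and only if $Y$ is an analytic (holomorphic) function of $\zeta$, i.e. $Y_{,\bar\zeta}=0$, the equation $$2\mathcal{C} = Y_{,\zeta} + \bar{Y}_{,\bar\zeta} + 2\bigl(Y Z_{,\zeta} + \bar{Y} Z_{,\bar\zeta}\bigr)$$ is satisfied and, in the non-plane symmetric cases $\Sigma(r)=\sin r$ and $\Sigma(r)=\sinh r$, $\mathcal{C}=0$. In that case the divergence $\psi$ of $\xi^a$ is $$\psi = \mathcal{C} + \xi^a X_{,a} = (X+Z)_{,a}\,\xi^a + \tfrac12\bigl(Y_{,\zeta}+\bar{Y}_{,\bar\zeta}\bigr).$$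
   Context: A conformal vector of a metric $g_{ab}$ with Levi-Civita derivative denoted by a semicolon is a vector field $\xi^a$ satisfying $\xi_{a;b} = F_{ab} + \psi g_{ab}$ with $F_{ab}$ antisymmetric and $\psi$ a (not necessarily constant) scalar function; equivalently $\mathcal{L}_\xi g_{ab} = 2\psi g_{ab}$. The scalar $\psi$ is called the divergence of $\xi^a$. Commas denote partial derivatives; $\partial_\zeta$ and $\partial_{\bar\zeta}$ are the usual Wirtinger derivatives with respect to the complex coordinate $\zeta$ and its conjugate $\bar\zeta$, which parametrize the two real dimensions orthogonal to the $(t,r)$ surfaces. The signature is $(+,-,-,-)$. The plane symmetric case is $\Sigma=1$ (flat $(t,r)$ surfaces); the other two cases are the non-plane symmetric ones. *)

theory Defs
  imports "HOL-Complex_Analysis.Complex_Analysis"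
begin

section \<open>Smooth functions and Wirtinger derivatives\<close>

text \<open>Only used on open sets, where the derivatives below are the honest Frechet derivatives.\<close>

primrec Ck_on :: "nat \<Rightarrow> ('a::euclidean_space \<Rightarrow> 'b::real_normed_vector) \<Rightarrow> 'a set \<Rightarrow> bool" where
  "Ck_on 0 f S \<longleftrightarrow> continuous_on S f"
| "Ck_on (Suc k) f S \<longleftrightarrow>
     (\<forall>x\<in>S. f differentiable (at x)) \<and>
     (\<forall>v. Ck_on k (\<lambda>x. frechet_derivative f (at x) v) S)"

definition smooth_on :: "('a::euclidean_space \<Rightarrow> 'b::real_normed_vector) \<Rightarrow> 'a set \<Rightarrow> bool" where
  "smooth_on f S \<longleftrightarrow> (\<forall>k. Ck_on k f S)"

definition d_zeta :: "(complex \<Rightarrow> complex) \<Rightarrow> complex \<Rightarrow> complex" where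
  "d_zeta f z = (frechet_derivative f (at z) 1 - \<i> * frechet_derivative f (at z) \<i>) / 2"

definition d_zetabar :: "(complex \<Rightarrow> complex) \<Rightarrow> complex \<Rightarrow> complex" where
  "d_zetabar f z = (frechet_derivative f (at z) 1 + \<i> * frechet_derivative f (at z) \<i>) / 2"

section \<open>Conformal vectors of a metric in a coordinate domain\<close>

text \<open>A metric on an open set of \<open>\<real>\<^sup>n\<close> is given by its component matrix
  \<open>g p $ a $ b\<close> in the coordinate frame.\<close>

definition partial :: "'n \<Rightarrow> (real^'n \<Rightarrow> real) \<Rightarrow> real^'n::finite \<Rightarrow> real" where
  "partial a f p = frechet_derivative f (at p) (axis a 1)"

definition christoffel :: "(real^'n \<Rightarrow> real^'n^'n) \<Rightarrow> real^'n::finite \<Rightarrow> 'n \<Rightarrow> 'n \<Rightarrow> 'n \<Rightarrow> real" where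
  "christoffel g p c a b = (1/2) * (\<Sum>d\<in>UNIV. matrix_inv (g p) $ c $ d *
     (partial a (\<lambda>q. g q $ d $ b) p + partial b (\<lambda>q. g q $ d $ a) p
      - partial d (\<lambda>q. g q $ a $ b) p))"

definition lower :: "(real^'n \<Rightarrow> real^'n^'n) \<Rightarrow> (real^'n \<Rightarrow> real^'n) \<Rightarrow> real^'n::finite \<Rightarrow> real^'n" where
  "lower g \<xi> p = g p *v \<xi> p"

text \<open>\<open>cov_deriv g w a b\<close> is \<open>w\<^bsub>a;b\<^esub>\<close> for a covector field \<open>w\<close>; the second index is the
  direction of differentiation.\<close>

definition cov_deriv ::
  "(real^'n \<Rightarrow> real^'n^'n) \<Rightarrow> (real^'n \<Rightarrow> real^'n) \<Rightarrow> 'n \<Rightarrow> 'n \<Rightarrow> real^'n::finite \<Rightarrow> real" where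
  "cov_deriv g w a b p =
     partial b (\<lambda>q. w q $ a) p - (\<Sum>c\<in>UNIV. christoffel g p c a b * w p $ c)"

definition conformal_vector_with_divergence ::
  "(real^'n \<Rightarrow> real^'n^'n) \<Rightarrow> (real^'n) set \<Rightarrow> (real^'n \<Rightarrow> real^'n) \<Rightarrow> (real^'n::finite \<Rightarrow> real) \<Rightarrow> bool" where
  "conformal_vector_with_divergence g U \<xi> \<psi> \<longleftrightarrow>
     (\<exists>F :: real^'n \<Rightarrow> real^'n^'n. \<forall>p\<in>U.
        (\<forall>a b. F p $ a $ b = - F p $ b $ a) \<and>
        (\<forall>a b. cov_deriv g (lower g \<xi>) a b p = F p $ a $ b + \<psi> p * g p $ a $ b))"

definition conformal_vector ::
  "(real^'n \<Rightarrow> real^'n^'n) \<Rightarrow> (real^'n) set \<Rightarrow> (real^'n::finite \<Rightarrow> real^'n) \<Rightarrow> bool" where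
  "conformal_vector g U \<xi> \<longleftrightarrow> (\<exists>\<psi>. conformal_vector_with_divergence g U \<xi> \<psi>)"

definition deriv_along :: "(real^'n \<Rightarrow> real^'n) \<Rightarrow> (real^'n \<Rightarrow> real) \<Rightarrow> real^'n::finite \<Rightarrow> real" where
  "deriv_along \<xi> f p = (\<Sum>a\<in>UNIV. \<xi> p $ a * partial a f p)"

section \<open>The timelike-surface homogeneous metric\<close>

text \<open>Real coordinates on \<open>\<real>\<^sup>4\<close>: components 1, 2 are \<open>t\<close>, \<open>r\<close> and components 3, 4 are the
  real and imaginary part of \<open>\<zeta> = x + \<i> y\<close>, so that \<open>d\<zeta> d\<zeta>\<^sup>* = dx\<^sup>2 + dy\<^sup>2\<close>.\<close>

definition zeta :: "real^4 \<Rightarrow> complex" where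
  "zeta p = Complex (p $ 3) (p $ 4)"

definition tsh_metric ::
  "(real \<Rightarrow> real) \<Rightarrow> (complex \<Rightarrow> real) \<Rightarrow> (complex \<Rightarrow> real) \<Rightarrow> real^4 \<Rightarrow> real^4^4" where
  "tsh_metric S X Z p =
     (let r = p $ 2; \<zeta> = zeta p in
      exp (2 * X \<zeta>) *\<^sub>R vector
       [vector [(S r)\<^sup>2, 0, 0, 0],
        vector [0, -1, 0, 0],
        vector [0, 0, - 2 * exp (2 * Z \<zeta>), 0],
        vector [0, 0, 0, - 2 * exp (2 * Z \<zeta>)]])"

text \<open>In real coordinates, \<open>Y \<partial>\<^sub>\<zeta>\<close> plus its complex conjugate is \<open>Re Y \<partial>\<^sub>x + Im Y \<partial>\<^sub>y\<close>.\<close>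

definition xi_field :: "(complex \<Rightarrow> complex) \<Rightarrow> real \<Rightarrow> real^4 \<Rightarrow> real^4" where
  "xi_field Y c p = vector [c * p $ 1, c * p $ 2, Re (Y (zeta p)), Im (Y (zeta p))]"

text \<open>The two encodings above agree with the line element and the vector field written in terms of
  \<open>\<zeta>\<close> and its conjugate.\<close>

lemma vector_4_nth [simp]: "(vector [a,b,c,d] :: 'a::zero^4) $ 1 = a" "(vector [a,b,c,d] :: 'a::zero^4) $ 2 = b"
  "(vector [a,b,c,d] :: 'a::zero^4) $ 3 = c" "(vector [a,b,c,d] :: 'a::zero^4) $ 4 = d"
  by (simp_all add: vector_def)
lemma tsh_metric_line_element:
  "v \<bullet> (tsh_metric S X Z p *v v) = exp (2 * X (zeta p)) *
     ((S (p $ 2))\<^sup>2 * (v $ 1)\<^sup>2 - (v $ 2)\<^sup>2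
      - 2 * exp (2 * Z (zeta p)) * (cmod (zeta v))\<^sup>2)"
  by (simp add: tsh_metric_def Let_def inner_vec_def matrix_vector_mult_def sum_4 zeta_def
      cmod_def power2_eq_square algebra_simps)
lemma bounded_linear_zeta: "bounded_linear zeta"
  unfolding linear_conv_bounded_linear[symmetric]
  by (rule linearI) (auto simp: zeta_def complex_eq_iff)

lemma xi_field_deriv_along:
  assumes f: "f differentiable (at (zeta p))"
  shows "complex_of_real (deriv_along (xi_field Y c) (\<lambda>q. f (zeta q)) p) =
     Y (zeta p) * d_zeta (\<lambda>w. complex_of_real (f w)) (zeta p)
     + cnj (Y (zeta p)) * d_zetabar (\<lambda>w. complex_of_real (f w)) (zeta p)"
proof -
  obtain f' where f': "(f has_derivative f') (at (zeta p))" using f unfolding differentiable_def by blast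
  have z: "(zeta has_derivative zeta) (at p)"
    by (rule bounded_linear.has_derivative[OF bounded_linear_zeta has_derivative_ident, simplified])
  have 1: "((\<lambda>q. f (zeta q)) has_derivative (\<lambda>v. f' (zeta v))) (at p)"
    using has_derivative_compose[OF z f'] .
  have 2: "((\<lambda>w. complex_of_real (f w)) has_derivative (\<lambda>v. complex_of_real (f' v))) (at (zeta p))"
    by (rule bounded_linear.has_derivative[OF bounded_linear_of_real f'])
  have l: "linear f'" using f' has_derivative_linear by blast
  have e: "zeta (axis 1 1) = 0" "zeta (axis 2 1) = 0" "zeta (axis 3 1) = 1" "zeta (axis 4 1) = \<i>"
    by (auto simp: zeta_def axis_def complex_eq_iff)
  show ?thesis
    using l unfolding deriv_along_def partial_def d_zeta_def d_zetabar_def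
     frechet_derivative_at[OF 1, symmetric] frechet_derivative_at[OF 2, symmetric]
    by (simp add: sum_4 e linear_0 xi_field_def complex_eq_iff field_simps)
qed

end

theory Submission
  imports Defs
begin

text \<open>The antisymmetric part of \<open>\<xi>\<^bsub>a;b\<^esub>\<close> can always serve as \<open>F\<close>, so only the symmetric part matters, and
  twice that is the Lie derivative of the metric along \<open>\<xi>\<close>. For the diagonal metric at hand its components
  decouple: \<open>rr\<close> gives \<open>\<psi> = c + \<xi>\<^sup>a X\<^bsub>,a\<^esub>\<close>, \<open>tt\<close> then requires \<open>c r S' = 0\<close>, and the block orthogonal to
  the \<open>(t, r)\<close> surfaces gives the Cauchy-Riemann equations together with \<open>c = Re Y\<^bsub>,\<zeta>\<^esub> + \<xi>\<^sup>a Z\<^bsub>,a\<^esub>\<close>; all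
  remaining components vanish identically.\<close>

no_notation fps_nth (infixl "$" 75)

section \<open>Conformal vectors through the Lie derivative of the metric\<close>

lemma partial_eq:
  assumes "(f has_derivative f') (at p)"
  shows "partial a f p = f' (axis a 1)"
  using frechet_derivative_at[OF assms] by (simp add: partial_def)

text \<open>Expanding \<open>\<xi> p\<close> in the coordinate basis, linearity of \<open>f'\<close>
  collapses the sum over coordinates; derivatives along a field can then be read off a Frechet
  derivative.\<close>

lemma deriv_along_eq:
  fixes p :: "real^'n::finite"
  assumes f: "(f has_derivative f') (at p)"
  shows "deriv_along \<xi> f p = f' (\<xi> p)"
proof -
  interpret linear f' using f by (rule has_derivative_linear)
  have "f' (\<xi> p) = f' (\<Sum>a\<in>UNIV. (\<xi> p $ a) *\<^sub>R axis a 1)"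
    using basis_expansion[of "\<xi> p"] by (simp add: scalar_mult_eq_scaleR)
  then show ?thesis
    by (simp add: deriv_along_def partial_eq[OF f] sum scale)
qed

text \<open>The coordinate form of the Lie derivative, free of Christoffel symbols. The free index
  comes first in both metric factors, which agrees with the usual formula for symmetric
  \<open>g\<close>.\<close>

definition lie_metric ::
  "(real^'n \<Rightarrow> real^'n^'n) \<Rightarrow> (real^'n \<Rightarrow> real^'n) \<Rightarrow> 'n \<Rightarrow> 'n \<Rightarrow> real^'n::finite \<Rightarrow> real" where
  "lie_metric g \<xi> a b p = deriv_along \<xi> (\<lambda>q. g q $ a $ b) p
     + (\<Sum>d\<in>UNIV. g p $ a $ d * partial b (\<lambda>q. \<xi> q $ d) p
                  + g p $ b $ d * partial a (\<lambda>q. \<xi> q $ d) p)"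

lemma partial_lower:
  assumes g: "\<And>d. (\<lambda>q. g q $ a $ d) differentiable at p"
    and \<xi>: "\<And>d. (\<lambda>q. \<xi> q $ d) differentiable at p"
  shows "partial b (\<lambda>q. lower g \<xi> q $ a) p =
    (\<Sum>d\<in>UNIV. g p $ a $ d * partial b (\<lambda>q. \<xi> q $ d) p
                 + \<xi> p $ d * partial b (\<lambda>q. g q $ a $ d) p)"
proof -
  note hg = g[unfolded frechet_derivative_works] and h\<xi> = \<xi>[unfolded frechet_derivative_works]
  have "((\<lambda>q. \<Sum>d\<in>UNIV. g q $ a $ d * \<xi> q $ d) has_derivative
     (\<lambda>h. \<Sum>d\<in>UNIV. g p $ a $ d * frechet_derivative (\<lambda>q. \<xi> q $ d) (at p) h
                 + frechet_derivative (\<lambda>q. g q $ a $ d) (at p) h * \<xi> p $ d)) (at p)"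
    by (intro has_derivative_sum has_derivative_mult hg h\<xi>)
  from partial_eq[OF this, of b] show ?thesis
    by (simp add: lower_def matrix_vector_mult_def partial_def mult.commute)
qed

text \<open>Lowering the index of \<open>\<xi>\<close> contracts the metric with the inverse inside
  \<open>christoffel\<close> to a Kronecker delta, so no inverse matrix has to be computed
  later.\<close>

lemma christoffel_lower:
  fixes p :: "real^'n::finite"
  assumes inv: "invertible (g p)"
    and sym: "\<And>a b. g p $ a $ b = g p $ b $ a"
  shows "(\<Sum>c\<in>UNIV. christoffel g p c a b * lower g \<xi> p $ c) =
    (1/2) * (\<Sum>d\<in>UNIV. \<xi> p $ d * (partial a (\<lambda>q. g q $ d $ b) p
       + partial b (\<lambda>q. g q $ d $ a) p - partial d (\<lambda>q. g q $ a $ b) p))"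
proof -
  define K where "K d = partial a (\<lambda>q. g q $ d $ b) p
       + partial b (\<lambda>q. g q $ d $ a) p - partial d (\<lambda>q. g q $ a $ b) p" for d
  \<comment> \<open>\<open>matrix_inv\<close> selects a two-sided inverse by choice; invertibility
    guarantees that one exists.\<close>
  have "g p ** matrix_inv (g p) = mat 1"
    using someI_ex[OF inv[unfolded invertible_def]] by (simp add: matrix_inv_def)
  then have id: "(\<Sum>c\<in>UNIV. g p $ e $ c * matrix_inv (g p) $ c $ d) = (if e = d then 1 else 0)" for d e
    by (simp add: matrix_matrix_mult_def mat_def vec_eq_iff)
  have "(\<Sum>c\<in>UNIV. christoffel g p c a b * lower g \<xi> p $ c) =
     (\<Sum>c\<in>UNIV. \<Sum>d\<in>UNIV. \<Sum>e\<in>UNIV. (1/2) * K d * \<xi> p $ e * (g p $ e $ c * matrix_inv (g p) $ c $ d))"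
    unfolding christoffel_def K_def[symmetric] lower_def matrix_vector_mult_def
    by (simp add: sum_distrib_left sum_distrib_right sym[of _ "_"] mult_ac)
       (simp add: sym sum_divide_distrib mult_ac)
  \<comment> \<open>The sum over \<open>c\<close> moves innermost, where \<open>id\<close> can
    contract it.\<close>
  also have "\<dots> = (\<Sum>d\<in>UNIV. \<Sum>e\<in>UNIV. \<Sum>c\<in>UNIV. (1/2) * K d * \<xi> p $ e * (g p $ e $ c * matrix_inv (g p) $ c $ d))"
    by (subst sum.swap) (intro sum.cong refl sum.swap)
  also have "\<dots> = (\<Sum>d\<in>UNIV. \<Sum>e\<in>UNIV. (1/2) * K d * \<xi> p $ e * (if e = d then 1 else 0))"
    unfolding sum_distrib_left[symmetric] id ..
  also have "\<dots> = (1/2) * (\<Sum>d\<in>UNIV. \<xi> p $ d * K d)"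
    by (simp add: sum_distrib_left if_distrib mult_ac cong: if_cong)
  finally show ?thesis unfolding K_def .
qed

text \<open>Lowering the index produces, by the product rule, the derivatives of
  \<open>g $ a $ d\<close> in direction \<open>b\<close> and of \<open>g $ b $ d\<close> in
  direction \<open>a\<close>. The two equal Christoffel terms cancel both and leave the derivative
  of \<open>g $ a $ b\<close> in direction \<open>d\<close>, contracted with
  \<open>\<xi>\<close>.\<close>

lemma cov_deriv_lower_symmetrized:
  fixes p :: "real^'n::finite"
  assumes inv: "invertible (g p)"
    and sym: "\<And>q a b. g q $ a $ b = g q $ b $ a"
    and g: "\<And>a b. (\<lambda>q. g q $ a $ b) differentiable at p"
    and \<xi>: "\<And>d. (\<lambda>q. \<xi> q $ d) differentiable at p"
  shows "cov_deriv g (lower g \<xi>) a b p + cov_deriv g (lower g \<xi>) b a p = lie_metric g \<xi> a b p"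
proof -
  \<comment> \<open>An equation between functions, since symmetry has to be applied under
    \<open>partial\<close>.\<close>
  have s: "(\<lambda>q. g q $ d $ e) = (\<lambda>q. g q $ e $ d)" for d e
    using sym by auto
  let ?P = "\<lambda>e d f. partial e (\<lambda>q. g q $ d $ f) p"
  let ?D = "\<lambda>e d. partial e (\<lambda>q. \<xi> q $ d) p"
  have "cov_deriv g (lower g \<xi>) a b p + cov_deriv g (lower g \<xi>) b a p =
      (\<Sum>d\<in>UNIV. g p $ a $ d * ?D b d + \<xi> p $ d * ?P b a d)
      - (1/2) * (\<Sum>d\<in>UNIV. \<xi> p $ d * (?P a d b + ?P b d a - ?P d a b))
      + ((\<Sum>d\<in>UNIV. g p $ b $ d * ?D a d + \<xi> p $ d * ?P a b d)
      - (1/2) * (\<Sum>d\<in>UNIV. \<xi> p $ d * (?P b d a + ?P a d b - ?P d b a)))"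
    unfolding cov_deriv_def christoffel_lower[where g = g and p = p, OF inv sym]
      partial_lower[OF g \<xi>] ..
  also have "\<dots> = (\<Sum>d\<in>UNIV. (g p $ a $ d * ?D b d + \<xi> p $ d * ?P b a d)
      - (1/2) * (\<xi> p $ d * (?P a d b + ?P b d a - ?P d a b))
      + ((g p $ b $ d * ?D a d + \<xi> p $ d * ?P a b d)
      - (1/2) * (\<xi> p $ d * (?P b d a + ?P a d b - ?P d b a))))"
    by (simp only: sum.distrib sum_subtractf sum_distrib_left)
  also have "\<dots> = (\<Sum>d\<in>UNIV. \<xi> p $ d * ?P d a b + (g p $ a $ d * ?D b d + g p $ b $ d * ?D a d))"
  proof (rule sum.cong[OF refl])
    fix d
    show "(g p $ a $ d * ?D b d + \<xi> p $ d * ?P b a d)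
      - (1/2) * (\<xi> p $ d * (?P a d b + ?P b d a - ?P d a b))
      + ((g p $ b $ d * ?D a d + \<xi> p $ d * ?P a b d)
      - (1/2) * (\<xi> p $ d * (?P b d a + ?P a d b - ?P d b a))) =
      \<xi> p $ d * ?P d a b + (g p $ a $ d * ?D b d + g p $ b $ d * ?D a d)"
      unfolding s[of d a] s[of d b] s[of b a] by (simp add: field_simps)
  qed
  finally show ?thesis
    by (simp only: lie_metric_def deriv_along_def sum.distrib)
qed

lemma conformal_vector_with_divergence_iff_lie:
  fixes g :: "real^'n::finite \<Rightarrow> real^'n^'n"
  assumes inv: "\<And>p. p \<in> U \<Longrightarrow> invertible (g p)"
    and sym: "\<And>q a b. g q $ a $ b = g q $ b $ a"
    and g: "\<And>p a b. p \<in> U \<Longrightarrow> (\<lambda>q. g q $ a $ b) differentiable at p"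
    and \<xi>: "\<And>p d. p \<in> U \<Longrightarrow> (\<lambda>q. \<xi> q $ d) differentiable at p"
  shows "conformal_vector_with_divergence g U \<xi> \<psi> \<longleftrightarrow>
    (\<forall>p\<in>U. \<forall>a b. lie_metric g \<xi> a b p = 2 * \<psi> p * g p $ a $ b)"
    (is "?L \<longleftrightarrow> ?R")
proof -
  let ?w = "\<lambda>a b p. cov_deriv g (lower g \<xi>) a b p"
  have lie: "lie_metric g \<xi> a b p = ?w a b p + ?w b a p" if "p \<in> U" for a b p
    using cov_deriv_lower_symmetrized[OF inv sym g \<xi>] that by simp
  show ?thesis
  proof
    assume ?L
    then obtain F :: "real^'n \<Rightarrow> real^'n^'n" where
      F: "\<And>p a b. p \<in> U \<Longrightarrow> F p $ a $ b = - F p $ b $ a"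
         "\<And>p a b. p \<in> U \<Longrightarrow> ?w a b p = F p $ a $ b + \<psi> p * g p $ a $ b"
      unfolding conformal_vector_with_divergence_def by blast
    show ?R
    proof (intro ballI allI)
      fix p a b assume p: "p \<in> U"
      \<comment> \<open>Adding the equations for \<open>a b\<close> and \<open>b a\<close> cancels
        \<open>F\<close> and doubles the \<open>\<psi>\<close> term.\<close>
      show "lie_metric g \<xi> a b p = 2 * \<psi> p * g p $ a $ b"
        using F(1)[OF p, of a b] F(2)[OF p, of a b] F(2)[OF p, of b a] sym[of p b a]
        by (simp add: lie[OF p])
    qed
  next
    assume R: ?R
    define F :: "real^'n \<Rightarrow> real^'n^'n" where "F p = (\<chi> a b. (?w a b p - ?w b a p) / 2)" for p
    show ?L
      unfolding conformal_vector_with_divergence_def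
    proof (intro exI[of _ F] ballI conjI allI)
      fix p a b assume p: "p \<in> U"
      show "F p $ a $ b = - F p $ b $ a"
        by (simp add: F_def field_simps)
      show "?w a b p = F p $ a $ b + \<psi> p * g p $ a $ b"
        using R p lie[OF p, of a b] by (simp add: F_def field_simps)
    qed
  qed
qed

section \<open>The projection to the \<zeta> plane, nondegeneracy of the metric, and
  holomorphy\<close>

lemma smooth_on_has_derivative:
  assumes "smooth_on f A" "x \<in> A"
  shows "(f has_derivative frechet_derivative f (at x)) (at x)"
proof -
  have "Ck_on (Suc 0) f A" using assms(1) unfolding smooth_on_def by blast
  then show ?thesis using assms(2) by (simp add: frechet_derivative_works)
qed

lemma has_derivative_zeta: "(zeta has_derivative zeta) (at p)"
  by (rule bounded_linear.has_derivative[OF bounded_linear_zeta has_derivative_ident, simplified])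

lemma zeta_axis [simp]:
  "zeta (axis 1 1) = 0" "zeta (axis 2 1) = 0" "zeta (axis 3 1) = 1" "zeta (axis 4 1) = \<i>"
  by (auto simp: zeta_def axis_def complex_eq_iff)

text \<open>A surjective linear map between these spaces is open. This makes the image of the
  coordinate domain a proper domain for holomorphy of \<open>Y\<close>.\<close>

lemma open_zeta_image: "open U \<Longrightarrow> open (zeta ` U)"
proof (rule open_surjective_linear_image)
  show "linear zeta" using bounded_linear_zeta by (rule bounded_linear.linear)
  show "surj zeta"
  proof (rule surjI)
    show "zeta (vector [0, 0, Re z, Im z]) = z" for z
      by (simp add: zeta_def)
  qed
qed

lemma tsh_metric_sym: "tsh_metric S X Z q $ a $ b = tsh_metric S X Z q $ b $ a"
  using exhaust_4[of a] exhaust_4[of b] by (auto simp: tsh_metric_def Let_def)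

text \<open>A diagonal matrix without zero entries is injective. Only the \<open>tt\<close> entry
  could vanish; the others are nonzero multiples of exponentials.\<close>

lemma invertible_tsh_metric:
  assumes "S (p $ 2) \<noteq> 0"
  shows "invertible (tsh_metric S X Z p)"
  unfolding matrix_left_invertible_injective invertible_left_inverse
  using assms
  by (auto simp: inj_on_def vec_eq_iff forall_4 matrix_vector_mult_def sum_4 tsh_metric_def Let_def)

text \<open>The Cauchy-Riemann equations say that the real-linear derivative commutes with
  multiplication by \<open>\<i>\<close>. As 1 and \<open>\<i>\<close> span the plane over the reals,
  testing this at 1 already makes the derivative complex-linear.\<close>

lemma has_derivative_holomorphic_iff:
  assumes A: "open A" and f: "\<And>z. z \<in> A \<Longrightarrow> (f has_derivative f' z) (at z)"
  shows "f holomorphic_on A \<longleftrightarrow> (\<forall>z\<in>A. f' z \<i> = \<i> * f' z 1)"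
proof
  assume h: "f holomorphic_on A"
  show "\<forall>z\<in>A. f' z \<i> = \<i> * f' z 1"
  proof
    fix z assume z: "z \<in> A"
    then have "(f has_derivative (*) (deriv f z)) (at z)"
      using holomorphic_derivI[OF h A] by (simp add: has_field_derivative_def)
    from has_derivative_unique[OF f[OF z] this] show "f' z \<i> = \<i> * f' z 1" by simp
  qed
next
  assume CR: "\<forall>z\<in>A. f' z \<i> = \<i> * f' z 1"
  have "f field_differentiable at z" if z: "z \<in> A" for z
  proof -
    interpret linear "f' z" using f[OF z] by (rule has_derivative_linear)
    have "f' z h = f' z 1 * h" for h
    proof -
      have "f' z h = f' z (Re h *\<^sub>R 1 + Im h *\<^sub>R \<i>)"
        by (rule arg_cong[of _ _ "f' z"]) (simp add: complex_eq_iff)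
      also have "\<dots> = Re h *\<^sub>R f' z 1 + Im h *\<^sub>R (\<i> * f' z 1)"
        using CR z by (simp only: add scale)
      also have "\<dots> = f' z 1 * h" by (simp add: complex_eq_iff algebra_simps)
      finally show ?thesis .
    qed
    then have "f' z = (*) (f' z 1)" by (rule ext)
    from has_derivative_eq_rhs[OF f[OF z] this] show ?thesis
      unfolding field_differentiable_def has_field_derivative_def by (rule exI)
  qed
  then show "f holomorphic_on A"
    unfolding holomorphic_on_def by (blast intro: field_differentiable_at_within)
qed

section \<open>The Lie derivative of the timelike-surface homogeneous metric\<close>

lemma has_derivative_nth: "((\<lambda>q::real^4. q $ i) has_derivative (\<lambda>v. v $ i)) (at p)"
  by (rule bounded_linear.has_derivative[OF bounded_linear_vec_nth has_derivative_ident, simplified])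

lemma has_derivative_xi_field:
  assumes Y': "(Y has_derivative Y') (at (zeta p))"
  shows "((\<lambda>q. xi_field Y c q $ 1) has_derivative (\<lambda>v. c * v $ 1)) (at p)"
  "((\<lambda>q. xi_field Y c q $ 2) has_derivative (\<lambda>v. c * v $ 2)) (at p)"
  "((\<lambda>q. xi_field Y c q $ 3) has_derivative (\<lambda>v. Re (Y' (zeta v)))) (at p)"
  "((\<lambda>q. xi_field Y c q $ 4) has_derivative (\<lambda>v. Im (Y' (zeta v)))) (at p)"
  unfolding xi_field_def vector_4_nth
  by (intro has_derivative_Re has_derivative_Im has_derivative_mult_right has_derivative_nth
      has_derivative_compose[OF has_derivative_zeta Y'])+

lemma has_derivative_tsh_metric:
  assumes S': "(S has_real_derivative S') (at (p $ 2))"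
    and X': "(X has_derivative X') (at (zeta p))"
    and Z': "(Z has_derivative Z') (at (zeta p))"
  shows "((\<lambda>q. tsh_metric S X Z q $ 1 $ 1) has_derivative
     (\<lambda>v. exp (2 * X (zeta p)) * (2 * X' (zeta v) * (S (p $ 2))\<^sup>2 + 2 * S (p $ 2) * S' * v $ 2))) (at p)"
  "((\<lambda>q. tsh_metric S X Z q $ 2 $ 2) has_derivative
     (\<lambda>v. - exp (2 * X (zeta p)) * (2 * X' (zeta v)))) (at p)"
  "((\<lambda>q. tsh_metric S X Z q $ 3 $ 3) has_derivative
     (\<lambda>v. - exp (2 * X (zeta p)) * (4 * exp (2 * Z (zeta p))) * (X' (zeta v) + Z' (zeta v)))) (at p)"
  "((\<lambda>q. tsh_metric S X Z q $ 4 $ 4) has_derivative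
     (\<lambda>v. - exp (2 * X (zeta p)) * (4 * exp (2 * Z (zeta p))) * (X' (zeta v) + Z' (zeta v)))) (at p)"
  "a \<noteq> b \<Longrightarrow> ((\<lambda>q. tsh_metric S X Z q $ a $ b) has_derivative (\<lambda>v. 0)) (at p)"
proof -
  note comp = has_derivative_compose[OF has_derivative_zeta X']
    has_derivative_compose[OF has_derivative_zeta Z'] has_derivative_nth
  have S2: "((\<lambda>q. S (q $ 2)) has_derivative (\<lambda>v. S' * v $ 2)) (at p)"
    using has_derivative_compose[OF has_derivative_nth S'[unfolded has_field_derivative_def]] .
  show "((\<lambda>q. tsh_metric S X Z q $ 1 $ 1) has_derivative
     (\<lambda>v. exp (2 * X (zeta p)) * (2 * X' (zeta v) * (S (p $ 2))\<^sup>2 + 2 * S (p $ 2) * S' * v $ 2))) (at p)"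
    unfolding tsh_metric_def Let_def
    by (auto intro!: derivative_eq_intros S2 comp simp: fun_eq_iff algebra_simps power2_eq_square)
  show "((\<lambda>q. tsh_metric S X Z q $ 2 $ 2) has_derivative
     (\<lambda>v. - exp (2 * X (zeta p)) * (2 * X' (zeta v)))) (at p)"
    unfolding tsh_metric_def Let_def
    by (auto intro!: derivative_eq_intros comp simp: fun_eq_iff algebra_simps)
  show "((\<lambda>q. tsh_metric S X Z q $ 3 $ 3) has_derivative
     (\<lambda>v. - exp (2 * X (zeta p)) * (4 * exp (2 * Z (zeta p))) * (X' (zeta v) + Z' (zeta v)))) (at p)"
    unfolding tsh_metric_def Let_def
    by (auto intro!: derivative_eq_intros comp simp: fun_eq_iff algebra_simps)
  show "((\<lambda>q. tsh_metric S X Z q $ 4 $ 4) has_derivative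
     (\<lambda>v. - exp (2 * X (zeta p)) * (4 * exp (2 * Z (zeta p))) * (X' (zeta v) + Z' (zeta v)))) (at p)"
    unfolding tsh_metric_def Let_def
    by (auto intro!: derivative_eq_intros comp simp: fun_eq_iff algebra_simps)
  assume "a \<noteq> b"
  then have "(\<lambda>q. tsh_metric S X Z q $ a $ b) = (\<lambda>q. 0)"
    using exhaust_4[of a] exhaust_4[of b] by (auto simp: tsh_metric_def Let_def fun_eq_iff)
  then show "((\<lambda>q. tsh_metric S X Z q $ a $ b) has_derivative (\<lambda>v. 0)) (at p)"
    by simp
qed

lemma differentiable_xi_field:
  assumes "(Y has_derivative Y') (at (zeta p))"
  shows "(\<lambda>q. xi_field Y c q $ d) differentiable at p"
  using exhaust_4[of d] has_derivative_xi_field[OF assms, THEN differentiableI] by metis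

lemma differentiable_tsh_metric:
  assumes "(S has_real_derivative S') (at (p $ 2))"
    and "(X has_derivative X') (at (zeta p))"
    and "(Z has_derivative Z') (at (zeta p))"
  shows "(\<lambda>q. tsh_metric S X Z q $ a $ b) differentiable at p"
proof (cases "a = b")
  case True
  then show ?thesis
    using exhaust_4[of a] has_derivative_tsh_metric(1-4)[OF assms, THEN differentiableI] by metis
next
  case False
  from has_derivative_tsh_metric(5)[OF assms this] show ?thesis
    by (rule differentiableI)
qed

text \<open>Here \<open>s\<close> stands for the value of \<open>\<psi>\<close> at \<open>p\<close>,
  and \<open>D\<close> differentiates in the direction \<open>Y\<close>, the image of the field
  under \<open>zeta\<close>. All prefactors of the components are nonzero, so the conformal equation
  becomes linear algebra in the values of the derivatives.\<close>

lemma lie_tsh_metric_iff: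
  assumes S': "(S has_real_derivative S') (at (p $ 2))"
    and X': "(X has_derivative X') (at (zeta p))"
    and Z': "(Z has_derivative Z') (at (zeta p))"
    and Y': "(Y has_derivative Y') (at (zeta p))"
    and nz: "S (p $ 2) \<noteq> 0"
  defines "D \<equiv> \<lambda>f'. f' (Y (zeta p)) :: real"
  shows "(\<forall>a b. lie_metric (tsh_metric S X Z) (xi_field Y c) a b p
            = 2 * s * tsh_metric S X Z p $ a $ b) \<longleftrightarrow>
    s = c + D X' \<and> c * p $ 2 * S' = 0 \<and> Y' \<i> = \<i> * Y' 1 \<and> c = Re (Y' 1) + D Z'"
proof -
  let ?L = "lie_metric (tsh_metric S X Z) (xi_field Y c)"
  let ?E = "exp (2 * X (zeta p))" and ?F = "exp (2 * Z (zeta p))"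
  have zxi: "zeta (xi_field Y c p) = Y (zeta p)"
    by (simp add: zeta_def xi_field_def complex_eq_iff)
  \<comment> \<open>The \<open>t\<close> and \<open>r\<close> axes project to 0, so \<open>Y\<close>
    contributes nothing in these directions.\<close>
  have Y0: "Y' 0 = 0" using Y' has_derivative_linear linear_0 by blast
  note pxi = has_derivative_xi_field[OF Y', THEN partial_eq]
  note dg = has_derivative_tsh_metric[OF S' X' Z', THEN deriv_along_eq]
  have ent: "tsh_metric S X Z p $ 1 $ 1 = ?E * (S (p $ 2))\<^sup>2" "tsh_metric S X Z p $ 2 $ 2 = - ?E"
    "tsh_metric S X Z p $ 3 $ 3 = - 2 * ?E * ?F" "tsh_metric S X Z p $ 4 $ 4 = - 2 * ?E * ?F"
    by (simp_all add: tsh_metric_def Let_def)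
  have off: "tsh_metric S X Z p $ a $ b = 0" if "a \<noteq> b" for a b
    using that exhaust_4[of a] exhaust_4[of b] by (auto simp: tsh_metric_def Let_def)
  have xi2: "xi_field Y c p $ 2 = c * p $ 2"
    by (simp add: xi_field_def)
  \<comment> \<open>The scaling part of the field contributes \<open>c\<close> to both
    \<open>tt\<close> and \<open>rr\<close>; its \<open>r\<close> component also moves the profile,
    whence the extra term with \<open>S'\<close>.\<close>
  have L: "?L 1 1 p = ?E * S (p $ 2) * (2 * S (p $ 2) * (c + D X') + 2 * c * p $ 2 * S')"
    "?L 2 2 p = - 2 * ?E * (c + D X')"
    "?L 3 3 p = - 4 * ?E * ?F * (Re (Y' 1) + D X' + D Z')"
    "?L 4 4 p = - 4 * ?E * ?F * (Im (Y' \<i>) + D X' + D Z')"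
    "?L 3 4 p = - 2 * ?E * ?F * (Re (Y' \<i>) + Im (Y' 1))"
    "?L 4 3 p = - 2 * ?E * ?F * (Re (Y' \<i>) + Im (Y' 1))"
    and L0: "?L 1 2 p = 0" "?L 1 3 p = 0" "?L 1 4 p = 0" "?L 2 1 p = 0" "?L 2 3 p = 0" "?L 2 4 p = 0"
     "?L 3 1 p = 0" "?L 3 2 p = 0" "?L 4 1 p = 0" "?L 4 2 p = 0"
    unfolding lie_metric_def sum_4
    by (simp_all add: dg ent off pxi zxi xi2 Y0 D_def)
       (simp_all add: axis_def algebra_simps power2_eq_square)
  have "(\<forall>a b. ?L a b p = 2 * s * tsh_metric S X Z p $ a $ b) \<longleftrightarrow>
     S (p $ 2) * (c + D X') + c * p $ 2 * S' = s * S (p $ 2) \<and> c + D X' = s \<and>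
     Re (Y' 1) + D X' + D Z' = s \<and> Im (Y' \<i>) + D X' + D Z' = s \<and> Re (Y' \<i>) + Im (Y' 1) = 0"
  proof -
    have 1: "?L 1 1 p = 2 * s * (?E * (S (p $ 2))\<^sup>2) \<longleftrightarrow>
       S (p $ 2) * (c + D X') + c * p $ 2 * S' = s * S (p $ 2)"
    proof -
      \<comment> \<open>The common factor \<open>2 * ?E * S (p $ 2)\<close> is nonzero because
        \<open>S\<close> does not vanish at \<open>p\<close>.\<close>
      have "?L 1 1 p - 2 * s * (?E * (S (p $ 2))\<^sup>2) =
         2 * ?E * S (p $ 2) * (S (p $ 2) * (c + D X') + c * p $ 2 * S' - s * S (p $ 2))"
        unfolding L by (simp add: algebra_simps power2_eq_square)
      then show ?thesis using nz
        by (metis (no_types, lifting) eq_iff_diff_eq_0 exp_not_eq_zero mult_eq_0_iff zero_neq_numeral)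
    qed
    have 2: "?L 2 2 p = 2 * s * - ?E \<longleftrightarrow> c + D X' = s"
      unfolding L by auto
    have 3: "?L 3 3 p = 2 * s * (- 2 * ?E * ?F) \<longleftrightarrow> Re (Y' 1) + D X' + D Z' = s"
      unfolding L by auto
    have 4: "?L 4 4 p = 2 * s * (- 2 * ?E * ?F) \<longleftrightarrow> Im (Y' \<i>) + D X' + D Z' = s"
      unfolding L by auto
    have 5: "?L 3 4 p = 0 \<longleftrightarrow> Re (Y' \<i>) + Im (Y' 1) = 0" "?L 4 3 p = 0 \<longleftrightarrow> Re (Y' \<i>) + Im (Y' 1) = 0"
      unfolding L by auto
    show ?thesis
      unfolding forall_4 ent using 1 2 3 4 5 by (simp add: off L0) blast
  qed
  \<comment> \<open>The \<open>rr\<close> equation fixes \<open>s\<close> and reduces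
    \<open>tt\<close> to the \<open>S'\<close> condition. The difference of the 33 and 44 equations,
    together with 34, is the Cauchy-Riemann system; comparing 33 with \<open>rr\<close> removes
    \<open>D X'\<close> and gives the formula for \<open>c\<close>.\<close>
  also have "\<dots> \<longleftrightarrow> s = c + D X' \<and> c * p $ 2 * S' = 0 \<and> Y' \<i> = \<i> * Y' 1 \<and> c = Re (Y' 1) + D Z'"
    by (auto simp: complex_eq_iff algebra_simps)
  finally show ?thesis .
qed

section \<open>The profile functions, and Wirtinger derivatives in real terms\<close>

lemma profile_has_derivative:
  assumes "S = sin \<or> S = sinh \<or> S = (\<lambda>_. 1::real)"
  shows "(S has_real_derivative deriv S r) (at r)"
proof -
  have "\<exists>D. (S has_real_derivative D) (at r)"
    using assms DERIV_sin DERIV_const has_field_derivative_sinh[OF DERIV_ident] by blast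
  then show ?thesis
    using DERIV_imp_deriv by blast
qed

text \<open>Both profiles vanish at 0, so \<open>r\<close> is nonzero on \<open>U\<close>, and a
  nonzero \<open>c\<close> would force the derivative of \<open>S\<close> to vanish throughout
  \<open>U\<close>. For \<open>sinh\<close> one point contradicts this, since \<open>cosh\<close>
  has no zeros; for \<open>sin\<close> the openness of \<open>U\<close> matters, as
  \<open>cos\<close> does have zeros.\<close>

lemma profile_coefficient_zero:
  assumes S: "S = sin \<or> S = sinh"
    and U: "open U" "U \<noteq> {}" "\<forall>p\<in>U. S (p $ 2) \<noteq> 0"
    and zero: "\<And>p::real^4. p \<in> U \<Longrightarrow> c * p $ 2 * deriv S (p $ 2) = 0"
  shows "c = 0"
proof (rule ccontr)
  assume c: "c \<noteq> 0"
  obtain p where p: "p \<in> U" using U(2) by blast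
  have r: "q $ 2 \<noteq> 0" if "q \<in> U" for q
    using that U(3) S by force
  have S'0: "deriv S (q $ 2) = 0" if "q \<in> U" for q
    using zero[OF that] c r[OF that] by simp
  have "S = sin"
    using S S'0[OF p] DERIV_imp_deriv[OF has_field_derivative_sinh[OF DERIV_ident], of "p $ 2"] by auto
  then have cos0: "cos (q $ 2) = 0" if "q \<in> U" for q
    using S'0[OF that] DERIV_imp_deriv[OF DERIV_sin, of "q $ 2"] by simp
  \<comment> \<open>Since \<open>cos r\<close> vanishes on the open set \<open>U\<close>, so does its derivative \<open>- sin r\<close>.\<close>
  have "((\<lambda>q::real^4. cos (q $ 2)) has_derivative (\<lambda>v. - sin (p $ 2) * v $ 2)) (at p)"
    using has_derivative_compose[OF has_derivative_nth DERIV_cos[unfolded has_field_derivative_def]] .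
  then have "((\<lambda>q::real^4. 0) has_derivative (\<lambda>v. - sin (p $ 2) * v $ 2)) (at p)"
    by (rule has_derivative_transform_within_open[OF _ U(1) p]) (rule cos0)
  from has_derivative_unique[OF this has_derivative_const]
  have "- sin (p $ 2) * (axis 2 1 :: real^4) $ 2 = 0" by (rule fun_cong)
  then show False
    using U(3) p \<open>S = sin\<close> by (simp add: axis_def)
qed

text \<open>The second summand is the conjugate of the first, so the sum is real: it is the
  Euclidean divergence of the plane field with components \<open>Re Y\<close> and
  \<open>Im Y\<close>.\<close>

lemma d_zeta_add_d_zetabar_cnj:
  assumes "(Y has_derivative Y') (at z)"
  shows "d_zeta Y z + d_zetabar (\<lambda>w. cnj (Y w)) z = complex_of_real (Re (Y' 1) + Im (Y' \<i>))"
  unfolding d_zeta_def d_zetabar_def frechet_derivative_at[OF assms, symmetric]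
    frechet_derivative_at[OF has_derivative_cnj[OF assms], symmetric]
  by (simp add: complex_eq_iff field_simps)

lemma d_zetabar_eq_0_iff:
  "d_zetabar Y z = 0 \<longleftrightarrow> frechet_derivative Y (at z) \<i> = \<i> * frechet_derivative Y (at z) 1"
  by (auto simp: d_zetabar_def complex_eq_iff)

section \<open>From the pointwise conditions to the characterization on the whole domain\<close>

theorem theorem2:
  fixes S :: "real \<Rightarrow> real"
    and X Z :: "complex \<Rightarrow> real"
    and Y :: "complex \<Rightarrow> complex"
    and c :: real
    and U :: "(real^4) set"
  assumes S: "S = sin \<or> S = sinh \<or> S = (\<lambda>_. 1)"
    and U: "open U" "U \<noteq> {}" "\<forall>p\<in>U. S (p $ 2) \<noteq> 0"
    and X: "smooth_on X (zeta ` U)"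
    and Z: "smooth_on Z (zeta ` U)"
    and Y: "smooth_on Y (zeta ` U)"
  shows "(conformal_vector (tsh_metric S X Z) U (xi_field Y c) \<longleftrightarrow>
            Y holomorphic_on (zeta ` U) \<and>
            (\<forall>\<zeta>\<in>zeta ` U. 2 * complex_of_real c =
               d_zeta Y \<zeta> + d_zetabar (\<lambda>w. cnj (Y w)) \<zeta>
               + 2 * (Y \<zeta> * d_zeta (\<lambda>w. complex_of_real (Z w)) \<zeta>
                      + cnj (Y \<zeta>) * d_zetabar (\<lambda>w. complex_of_real (Z w)) \<zeta>)) \<and>
            (S = sin \<or> S = sinh \<longrightarrow> c = 0)) \<and>
         (Y holomorphic_on (zeta ` U) \<longleftrightarrow> (\<forall>\<zeta>\<in>zeta ` U. d_zetabar Y \<zeta> = 0)) \<and>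
         (\<forall>\<psi>. conformal_vector_with_divergence (tsh_metric S X Z) U (xi_field Y c) \<psi> \<longrightarrow>
            (\<forall>p\<in>U. \<psi> p = c + deriv_along (xi_field Y c) (\<lambda>q. X (zeta q)) p \<and>
                complex_of_real (\<psi> p) =
                  complex_of_real (deriv_along (xi_field Y c) (\<lambda>q. X (zeta q) + Z (zeta q)) p)
                  + (d_zeta Y (zeta p) + d_zetabar (\<lambda>w. cnj (Y w)) (zeta p)) / 2))"
proof -
  let ?g = "tsh_metric S X Z" and ?\<xi> = "xi_field Y c"
  let ?DX = "\<lambda>p. deriv_along ?\<xi> (\<lambda>q. X (zeta q)) p"
  let ?DZ = "\<lambda>p. deriv_along ?\<xi> (\<lambda>q. Z (zeta q)) p"
  let ?Y' = "\<lambda>p. frechet_derivative Y (at (zeta p))"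
  let ?CR = "\<lambda>p. ?Y' p \<i> = \<i> * ?Y' p 1"
  let ?eq = "\<lambda>\<zeta>. 2 * complex_of_real c = d_zeta Y \<zeta> + d_zetabar (\<lambda>w. cnj (Y w)) \<zeta>
               + 2 * (Y \<zeta> * d_zeta (\<lambda>w. complex_of_real (Z w)) \<zeta>
                      + cnj (Y \<zeta>) * d_zetabar (\<lambda>w. complex_of_real (Z w)) \<zeta>)"
  have X': "(X has_derivative frechet_derivative X (at (zeta p))) (at (zeta p))"
    and Z': "(Z has_derivative frechet_derivative Z (at (zeta p))) (at (zeta p))"
    and Y': "(Y has_derivative ?Y' p) (at (zeta p))" if "p \<in> U" for p
    by (rule smooth_on_has_derivative[OF X imageI[OF that]] smooth_on_has_derivative[OF Z imageI[OF that]]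
        smooth_on_has_derivative[OF Y imageI[OF that]])+
  note S' = profile_has_derivative[OF S]
  have zxi: "zeta (?\<xi> p) = Y (zeta p)" for p
    by (simp add: zeta_def xi_field_def complex_eq_iff)
  \<comment> \<open>\<open>zeta\<close> projects the field to \<open>Y\<close>, so functions of
    \<zeta> alone are differentiated in direction \<open>Y\<close>.\<close>
  have DX: "frechet_derivative X (at (zeta p)) (Y (zeta p)) = ?DX p"
    and DZ: "frechet_derivative Z (at (zeta p)) (Y (zeta p)) = ?DZ p"
    and DXZ: "deriv_along ?\<xi> (\<lambda>q. X (zeta q) + Z (zeta q)) p = ?DX p + ?DZ p"
    if p: "p \<in> U" for p
  proof -
    note compX = has_derivative_compose[OF has_derivative_zeta X'[OF p]]
      and compZ = has_derivative_compose[OF has_derivative_zeta Z'[OF p]]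
    show "frechet_derivative X (at (zeta p)) (Y (zeta p)) = ?DX p"
      "frechet_derivative Z (at (zeta p)) (Y (zeta p)) = ?DZ p"
      "deriv_along ?\<xi> (\<lambda>q. X (zeta q) + Z (zeta q)) p = ?DX p + ?DZ p"
      using deriv_along_eq[OF compX, of ?\<xi>] deriv_along_eq[OF compZ, of ?\<xi>]
        deriv_along_eq[OF has_derivative_add[OF compX compZ], of ?\<xi>] by (simp_all add: zxi)
  qed
  have conf: "conformal_vector_with_divergence ?g U ?\<xi> \<psi> \<longleftrightarrow>
     (\<forall>p\<in>U. \<psi> p = c + ?DX p \<and> c * p $ 2 * deriv S (p $ 2) = 0 \<and> ?CR p \<and>
        c = Re (?Y' p 1) + ?DZ p)" for \<psi>
  proof -
    have "conformal_vector_with_divergence ?g U ?\<xi> \<psi> \<longleftrightarrow>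
      (\<forall>p\<in>U. \<forall>a b. lie_metric ?g ?\<xi> a b p = 2 * \<psi> p * ?g p $ a $ b)"
    proof (rule conformal_vector_with_divergence_iff_lie)
      show "invertible (?g p)" if "p \<in> U" for p
        using invertible_tsh_metric U(3) that by blast
      show "(\<lambda>q. ?g q $ a $ b) differentiable at p" if "p \<in> U" for p a b
        using differentiable_tsh_metric[OF S' X'[OF that] Z'[OF that]] .
      show "(\<lambda>q. ?\<xi> q $ d) differentiable at p" if "p \<in> U" for p d
        using differentiable_xi_field[OF Y'[OF that]] .
    qed (rule tsh_metric_sym)
    also have "\<dots> \<longleftrightarrow> (\<forall>p\<in>U. \<psi> p = c + ?DX p \<and> c * p $ 2 * deriv S (p $ 2) = 0 \<and> ?CR p \<and>
        c = Re (?Y' p 1) + ?DZ p)"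
    proof (rule ball_cong[OF refl])
      fix p assume p: "p \<in> U"
      then have "S (p $ 2) \<noteq> 0" using U(3) by blast
      from lie_tsh_metric_iff[OF S' X'[OF p] Z'[OF p] Y'[OF p] this, of c "\<psi> p"]
      show "(\<forall>a b. lie_metric ?g ?\<xi> a b p = 2 * \<psi> p * ?g p $ a $ b) \<longleftrightarrow>
        \<psi> p = c + ?DX p \<and> c * p $ 2 * deriv S (p $ 2) = 0 \<and> ?CR p \<and> c = Re (?Y' p 1) + ?DZ p"
        unfolding DX[OF p] DZ[OF p] .
    qed
    finally show ?thesis .
  qed
  have hol: "Y holomorphic_on (zeta ` U) \<longleftrightarrow> (\<forall>p\<in>U. ?CR p)"
    using has_derivative_holomorphic_iff[OF open_zeta_image[OF U(1)] smooth_on_has_derivative[OF Y]]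
    by auto
  \<comment> \<open>By Cauchy-Riemann the two terms of the plane divergence of \<open>Y\<close>
    coincide, so the equation is twice the pointwise condition on \<open>c\<close>.\<close>
  have eq: "?eq (zeta p) \<longleftrightarrow> c = Re (?Y' p 1) + ?DZ p" if p: "p \<in> U" and CR: "?CR p" for p
  proof -
    have "Z differentiable at (zeta p)" using Z'[OF p] by (auto simp: differentiable_def)
    then have "?eq (zeta p) \<longleftrightarrow> complex_of_real (2 * c) =
        complex_of_real (Re (?Y' p 1) + Im (?Y' p \<i>) + 2 * ?DZ p)"
      unfolding d_zeta_add_d_zetabar_cnj[OF Y'[OF p]]
      \<comment> \<open>The Wirtinger expression does not mention the scaling constant, so reading
        the identity backwards requires naming one.\<close>
      by (subst xi_field_deriv_along[symmetric, where c = c]) simp_all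
    then show ?thesis unfolding of_real_eq_iff using CR by auto
  qed
  \<comment> \<open>For the constant profile \<open>deriv S\<close> is 0 and the left side holds for
    every \<open>c\<close>.\<close>
  have plane: "(\<forall>p\<in>U. c * p $ 2 * deriv S (p $ 2) = 0) \<longleftrightarrow> (S = sin \<or> S = sinh \<longrightarrow> c = 0)"
    using profile_coefficient_zero[OF _ U, of c] S by auto
  \<comment> \<open>Only the first conjunct of \<open>conf\<close> involves \<open>\<psi>\<close>,
    and it is solved by taking it as the definition of the witness.\<close>
  have "conformal_vector ?g U ?\<xi> \<longleftrightarrow>
      (\<forall>p\<in>U. c * p $ 2 * deriv S (p $ 2) = 0 \<and> ?CR p \<and> c = Re (?Y' p 1) + ?DZ p)"
    unfolding conformal_vector_def conf by (auto intro: exI[of _ "\<lambda>p. c + ?DX p"])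
  \<comment> \<open>\<open>eq\<close> presupposes the Cauchy-Riemann equations, which both sides of
    the equivalence supply.\<close>
  then have "conformal_vector ?g U ?\<xi> \<longleftrightarrow>
      Y holomorphic_on (zeta ` U) \<and> (\<forall>\<zeta>\<in>zeta ` U. ?eq \<zeta>) \<and> (S = sin \<or> S = sinh \<longrightarrow> c = 0)"
    unfolding hol plane[symmetric] ball_simps using eq by blast
  moreover have "Y holomorphic_on (zeta ` U) \<longleftrightarrow> (\<forall>\<zeta>\<in>zeta ` U. d_zetabar Y \<zeta> = 0)"
    unfolding hol d_zetabar_eq_0_iff by simp
  moreover have "\<psi> p = c + ?DX p \<and> complex_of_real (\<psi> p) =
      complex_of_real (deriv_along ?\<xi> (\<lambda>q. X (zeta q) + Z (zeta q)) p)
      + (d_zeta Y (zeta p) + d_zetabar (\<lambda>w. cnj (Y w)) (zeta p)) / 2"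
    if "conformal_vector_with_divergence ?g U ?\<xi> \<psi>" and p: "p \<in> U" for \<psi> p
  proof -
    have \<psi>: "\<psi> p = c + ?DX p" and CR: "?CR p" and c: "c = Re (?Y' p 1) + ?DZ p"
      using that conf by blast+
    \<comment> \<open>Substitute the condition for \<open>c\<close>, and use Cauchy-Riemann to write
      \<open>Re (?Y' p 1)\<close> as half the plane divergence of \<open>Y\<close>.\<close>
    then have "\<psi> p = ?DX p + ?DZ p + (Re (?Y' p 1) + Im (?Y' p \<i>)) / 2"
      by simp
    then have "complex_of_real (\<psi> p) = complex_of_real (?DX p + ?DZ p)
        + complex_of_real (Re (?Y' p 1) + Im (?Y' p \<i>)) / 2"
      by (simp only: of_real_add of_real_divide of_real_numeral)
    then show ?thesis
      unfolding d_zeta_add_d_zetabar_cnj[OF Y'[OF p]] DXZ[OF p] using \<psi> by blast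
  qed
  ultimately show ?thesis by blast
qed

end
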